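(* Let $R$ be a $G$-graded ring, let $M$ be a $G$-graded weakly topological $R$-module, let $\Upsilon_M$ carry the Zariski topology, and let $P\subseteq\Upsilon_M$ be a subset. (1) $P$ is an irreducible closed subset of $\Upsilon_M$ if and only if $P=\chi(I)$ for some $I\in\Upsilon_M$. As a result, every irreducible closed subset of $\Upsilon_M$ has a generic point. (2) The correspondence $\chi(I)\mapsto I$ is a bijection from the set of all irreducible components of $\Upsilon_M$ onto the set of all minimal elements of $\Upsilon_M$ (with respect to inclusion). (3) If $M$ is a $G$-graded pseudo weakly primeful $R$-module, then the set of all irreducible components of $\Upsilon_M$ is $H=\{\chi^M(LM): L \text{ is a minimal element of } \chi^R(Ann(M))\}$.
   Context: Conventions: $G$ is an abelian group with identity $e$; rings are commutative with identity and modules are unital. A ring $R$ is $G$-graded if $R=\bigoplus_{g\in G}R_g$ with additive subgroups $R_g$ and $R_gR_h\subseteq R_{gh}$; $h(R)=\bigcup_{g}R_g$. An ideal $I$ of $R$ is graded if $I=\bigoplus_g (I\cap R_g)$. An $R$-module $M$ is $G$-graded if $M=\bigoplus_{g}M_g$ with additive subgroups $M_g$ and $R_gM_h\subseteq M_{gh}$. A submodule $P$ of $M$ is graded if $P=\bigoplus_g (P\cap M_g)$. Put $(P:_RM)=\{r\in R: rM\subseteq P\}$ and $Ann(M)=(0:_RM)$. A proper graded ideal $I$ of $R$ is graded weakly prime if whenever $a,b\in h(R)$ and $0\neq ab\in I$, then $a\in I$ or $b\in I$. $GWSpec(R)$ is the set of graded weakly prime ideals of $R$; for a graded ideal $J$,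 $\chi^R(J)=\{I\in GWSpec(R): J\subseteq I\}$. A graded submodule $P$ of $M$ is graded pseudo weakly prime if $(P:_RM)$ is a graded weakly prime ideal of $R$; $\Upsilon_M$ is the set of all graded pseudo weakly prime submodules of $M$. A graded submodule of $M$ is graded pseudo weakly semiprime if it is an intersection of graded pseudo weakly prime submodules of $M$. A graded pseudo weakly prime submodule $P$ of $M$ is graded weakly extraordinary if whenever $I,J$ are graded pseudo weakly semiprime submodules of $M$ with $\{0\}\neq I\cap J\subseteq P$, then $I\subseteq P$ or $J\subseteq P$. $M$ is $G$-graded weakly topological if $\Upsilon_M=\emptyset$ or every graded pseudo weakly prime submodule of $M$ is graded weakly extraordinary. For a graded submodule $N$ of $M$, $\chi(N)=\chi^M(N)=\{I\in\Upsilon_M: N\subseteq I\}$. The Zariski topology on $\Upsilon_M$ is the topology whose closed sets are exactly the sets $\chi(N)$, $N$ a graded submodule of $M$. A nonempty subset $B$ of a topological space is irreducible if it is not the union of two proper subsets each closed in $B$; the empty set is not considered irreducible. An irreducible component is a maximal irreducible subset. A generic point of a closed subset $X$ is a point $x\in X$ with $X=Cl(\{x\})$. The natural map is $\varphi:\Upsilon_M\to GWSpec(R/Ann(M))$, $\varphi(P)=(P:_RM)/Ann(M)$. $M$ is $G$-graded pseudo weakly primeful if either $M=\{0\}$, or $M\neq\{0\}$ and $\varphi$ is surjective. *)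

theory Defs
  imports "HOL-Algebra.Module" "HOL-Algebra.QuotRing" "HOL-Algebra.Generated_Groups"
    "HOL-Analysis.Abstract_Topology"
begin

section \<open>Graded rings, ideals, modules and submodules\<close>

text \<open>\<open>Y\<close> is the internal direct sum of the additive subgroups \<open>S g\<close>, \<open>g \<in> I\<close>: summation is a
  bijection from the finitely supported families \<open>(c g)\<close> with \<open>c g \<in> S g\<close> onto \<open>Y\<close>.\<close>

definition internal_direct_sum ::
  "('a, 'r) ring_scheme \<Rightarrow> 'g set \<Rightarrow> ('g \<Rightarrow> 'a set) \<Rightarrow> 'a set \<Rightarrow> bool" where
  "internal_direct_sum A I S Y \<longleftrightarrow>
     (\<forall>g\<in>I. additive_subgroup (S g) A) \<and>
     bij_betw (\<lambda>c. finsum A c {g \<in> I. c g \<noteq> \<zero>\<^bsub>A\<^esub>})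
       {c \<in> (\<Pi>\<^sub>E g\<in>I. S g). finite {g \<in> I. c g \<noteq> \<zero>\<^bsub>A\<^esub>}} Y"

locale graded_ring = grp: comm_group G + cring R
  for G :: "('g, 'c) monoid_scheme" and R :: "('a, 'r) ring_scheme" (structure)
    and Rg :: "'g \<Rightarrow> 'a set" +
  assumes ring_direct_sum: "internal_direct_sum R (carrier G) Rg (carrier R)"
    and ring_mult: "\<lbrakk>g \<in> carrier G; h \<in> carrier G; a \<in> Rg g; b \<in> Rg h\<rbrakk>
      \<Longrightarrow> a \<otimes> b \<in> Rg (g \<otimes>\<^bsub>G\<^esub> h)"

locale graded_module = graded_ring G R Rg + Module.module R M
  for G :: "('g, 'c) monoid_scheme" and R :: "('a, 'r) ring_scheme" (structure)
    and Rg :: "'g \<Rightarrow> 'a set"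
    and M :: "('a, 'b, 'm) module_scheme" (structure) and Mg :: "'g \<Rightarrow> 'b set" +
  assumes module_direct_sum: "internal_direct_sum M (carrier G) Mg (carrier M)"
    and module_smult: "\<lbrakk>g \<in> carrier G; h \<in> carrier G; a \<in> Rg g; x \<in> Mg h\<rbrakk>
      \<Longrightarrow> a \<odot>\<^bsub>M\<^esub> x \<in> Mg (g \<otimes>\<^bsub>G\<^esub> h)"

definition homogeneous_elements :: "('g, 'c) monoid_scheme \<Rightarrow> ('g \<Rightarrow> 'a set) \<Rightarrow> 'a set" where
  "homogeneous_elements G Rg = (\<Union>g\<in>carrier G. Rg g)"

definition graded_ideal ::
  "('g, 'c) monoid_scheme \<Rightarrow> ('a, 'r) ring_scheme \<Rightarrow> ('g \<Rightarrow> 'a set) \<Rightarrow> 'a set \<Rightarrow> bool" where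
  "graded_ideal G R Rg I \<longleftrightarrow>
     ideal I R \<and> internal_direct_sum R (carrier G) (\<lambda>g. I \<inter> Rg g) I"

definition graded_submodule ::
  "('g, 'c) monoid_scheme \<Rightarrow> ('a, 'r) ring_scheme \<Rightarrow> ('a, 'b, 'm) module_scheme
    \<Rightarrow> ('g \<Rightarrow> 'b set) \<Rightarrow> 'b set \<Rightarrow> bool" where
  "graded_submodule G R M Mg P \<longleftrightarrow>
     submodule P R M \<and> internal_direct_sum M (carrier G) (\<lambda>g. P \<inter> Mg g) P"

definition residual ::
  "('a, 'r) ring_scheme \<Rightarrow> ('a, 'b, 'm) module_scheme \<Rightarrow> 'b set \<Rightarrow> 'a set" where
  "residual R M P = {r \<in> carrier R. \<forall>x\<in>carrier M. r \<odot>\<^bsub>M\<^esub> x \<in> P}"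

definition annihilator :: "('a, 'r) ring_scheme \<Rightarrow> ('a, 'b, 'm) module_scheme \<Rightarrow> 'a set" where
  "annihilator R M = residual R M {\<zero>\<^bsub>M\<^esub>}"

text \<open>The product \<open>LM\<close> is the set of finite sums of elements \<open>l x\<close> with \<open>l \<in> L\<close>, \<open>x \<in> M\<close>, i.e.
  the additive subgroup generated by them.\<close>

definition ideal_module_prod :: "('a, 'b, 'm) module_scheme \<Rightarrow> 'a set \<Rightarrow> 'b set" where
  "ideal_module_prod M L = generate (add_monoid M) {l \<odot>\<^bsub>M\<^esub> x | l x. l \<in> L \<and> x \<in> carrier M}"

definition minimal_elements :: "'a set set \<Rightarrow> 'a set set" where
  "minimal_elements S = {P \<in> S. \<forall>Q\<in>S. Q \<subseteq> P \<longrightarrow> Q = P}"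

section \<open>Graded weakly prime ideals\<close>

definition graded_weakly_prime ::
  "('g, 'c) monoid_scheme \<Rightarrow> ('a, 'r) ring_scheme \<Rightarrow> ('g \<Rightarrow> 'a set) \<Rightarrow> 'a set \<Rightarrow> bool" where
  "graded_weakly_prime G R Rg I \<longleftrightarrow>
     graded_ideal G R Rg I \<and> I \<noteq> carrier R \<and>
     (\<forall>a\<in>homogeneous_elements G Rg. \<forall>b\<in>homogeneous_elements G Rg.
        a \<otimes>\<^bsub>R\<^esub> b \<noteq> \<zero>\<^bsub>R\<^esub> \<and> a \<otimes>\<^bsub>R\<^esub> b \<in> I \<longrightarrow> a \<in> I \<or> b \<in> I)"

definition GWSpec ::
  "('g, 'c) monoid_scheme \<Rightarrow> ('a, 'r) ring_scheme \<Rightarrow> ('g \<Rightarrow> 'a set) \<Rightarrow> 'a set set" where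
  "GWSpec G R Rg = {I. graded_weakly_prime G R Rg I}"

definition chi_ring ::
  "('g, 'c) monoid_scheme \<Rightarrow> ('a, 'r) ring_scheme \<Rightarrow> ('g \<Rightarrow> 'a set) \<Rightarrow> 'a set \<Rightarrow> 'a set set" where
  "chi_ring G R Rg J = {I \<in> GWSpec G R Rg. J \<subseteq> I}"

text \<open>For \<open>J \<subseteq> R\<close>, the image \<open>{J +> a | a \<in> Y}\<close> of \<open>Y\<close> in \<open>R Quot J\<close>. Applied to an ideal
  \<open>Y \<supseteq> J\<close> it is \<open>Y / J\<close>; applied to the components \<open>Rg g\<close> it is the grading of \<open>R Quot J\<close>.\<close>

definition quot_image :: "('a, 'r) ring_scheme \<Rightarrow> 'a set \<Rightarrow> 'a set \<Rightarrow> 'a set set" where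
  "quot_image R J Y = (\<lambda>a. J +>\<^bsub>R\<^esub> a) ` Y"

section \<open>Graded pseudo weakly prime submodules\<close>

definition Upsilon ::
  "('g, 'c) monoid_scheme \<Rightarrow> ('a, 'r) ring_scheme \<Rightarrow> ('g \<Rightarrow> 'a set)
    \<Rightarrow> ('a, 'b, 'm) module_scheme \<Rightarrow> ('g \<Rightarrow> 'b set) \<Rightarrow> 'b set set" where
  "Upsilon G R Rg M Mg =
     {P. graded_submodule G R M Mg P \<and> graded_weakly_prime G R Rg (residual R M P)}"

text \<open>Intersections are taken over nonempty families. Admitting the empty intersection \<open>M\<close> would
  not change the notion \<open>graded_weakly_extraordinary\<close> below, whose condition is trivially true
  when \<open>I\<close> or \<open>J\<close> is \<open>M\<close>.\<close>

definition graded_pseudo_weakly_semiprime ::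
  "('g, 'c) monoid_scheme \<Rightarrow> ('a, 'r) ring_scheme \<Rightarrow> ('g \<Rightarrow> 'a set)
    \<Rightarrow> ('a, 'b, 'm) module_scheme \<Rightarrow> ('g \<Rightarrow> 'b set) \<Rightarrow> 'b set \<Rightarrow> bool" where
  "graded_pseudo_weakly_semiprime G R Rg M Mg P \<longleftrightarrow>
     graded_submodule G R M Mg P \<and> (\<exists>\<S>. \<S> \<noteq> {} \<and> \<S> \<subseteq> Upsilon G R Rg M Mg \<and> P = \<Inter>\<S>)"

definition graded_weakly_extraordinary ::
  "('g, 'c) monoid_scheme \<Rightarrow> ('a, 'r) ring_scheme \<Rightarrow> ('g \<Rightarrow> 'a set)
    \<Rightarrow> ('a, 'b, 'm) module_scheme \<Rightarrow> ('g \<Rightarrow> 'b set) \<Rightarrow> 'b set \<Rightarrow> bool" where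
  "graded_weakly_extraordinary G R Rg M Mg P \<longleftrightarrow>
     P \<in> Upsilon G R Rg M Mg \<and>
     (\<forall>I J. graded_pseudo_weakly_semiprime G R Rg M Mg I \<and>
            graded_pseudo_weakly_semiprime G R Rg M Mg J \<and>
            I \<inter> J \<noteq> {\<zero>\<^bsub>M\<^esub>} \<and> I \<inter> J \<subseteq> P \<longrightarrow> I \<subseteq> P \<or> J \<subseteq> P)"

definition graded_weakly_topological ::
  "('g, 'c) monoid_scheme \<Rightarrow> ('a, 'r) ring_scheme \<Rightarrow> ('g \<Rightarrow> 'a set)
    \<Rightarrow> ('a, 'b, 'm) module_scheme \<Rightarrow> ('g \<Rightarrow> 'b set) \<Rightarrow> bool" where
  "graded_weakly_topological G R Rg M Mg \<longleftrightarrow>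
     Upsilon G R Rg M Mg = {} \<or>
     (\<forall>P\<in>Upsilon G R Rg M Mg. graded_weakly_extraordinary G R Rg M Mg P)"

definition natural_map ::
  "('a, 'r) ring_scheme \<Rightarrow> ('a, 'b, 'm) module_scheme \<Rightarrow> 'b set \<Rightarrow> 'a set set" where
  "natural_map R M P = quot_image R (annihilator R M) (residual R M P)"

definition graded_pseudo_weakly_primeful ::
  "('g, 'c) monoid_scheme \<Rightarrow> ('a, 'r) ring_scheme \<Rightarrow> ('g \<Rightarrow> 'a set)
    \<Rightarrow> ('a, 'b, 'm) module_scheme \<Rightarrow> ('g \<Rightarrow> 'b set) \<Rightarrow> bool" where
  "graded_pseudo_weakly_primeful G R Rg M Mg \<longleftrightarrow>
     carrier M = {\<zero>\<^bsub>M\<^esub>} \<or>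
     carrier M \<noteq> {\<zero>\<^bsub>M\<^esub>} \<and>
     natural_map R M ` Upsilon G R Rg M Mg =
       GWSpec G (R Quot annihilator R M) (\<lambda>g. quot_image R (annihilator R M) (Rg g))"

section \<open>The Zariski topology\<close>

definition chi ::
  "('g, 'c) monoid_scheme \<Rightarrow> ('a, 'r) ring_scheme \<Rightarrow> ('g \<Rightarrow> 'a set)
    \<Rightarrow> ('a, 'b, 'm) module_scheme \<Rightarrow> ('g \<Rightarrow> 'b set) \<Rightarrow> 'b set \<Rightarrow> 'b set set" where
  "chi G R Rg M Mg N = {I \<in> Upsilon G R Rg M Mg. N \<subseteq> I}"

text \<open>The topology on \<open>Upsilon\<close> with the sets \<open>chi N\<close> as a subbasis of closed sets. Whenever the
  sets \<open>chi N\<close> are exactly the closed sets of some topology, it is this one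
  (\<open>zariski_topology_unique\<close>). Passing to the generated topology
  is needed because finite unions of sets \<open>chi N\<close> can fail to be of this form even for weakly
  topological modules: for \<open>R = M = k \<times> k\<close> with \<open>k\<close> a field and the trivial grading, \<open>0\<close>,
  \<open>k \<times> 0\<close> and \<open>0 \<times> k\<close> are the pseudo weakly prime submodules, and \<open>{k \<times> 0, 0 \<times> k}\<close> is no
  \<open>chi N\<close>.\<close>

definition zariski_topology ::
  "('g, 'c) monoid_scheme \<Rightarrow> ('a, 'r) ring_scheme \<Rightarrow> ('g \<Rightarrow> 'a set)
    \<Rightarrow> ('a, 'b, 'm) module_scheme \<Rightarrow> ('g \<Rightarrow> 'b set) \<Rightarrow> 'b set topology" where
  "zariski_topology G R Rg M Mg = topology_generated_by
     {Upsilon G R Rg M Mg - chi G R Rg M Mg N | N. graded_submodule G R M Mg N}"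

lemma zariski_topology_unique:
  assumes top: "topspace T = Upsilon G R Rg M Mg"
    and closed: "\<And>C. closedin T C \<longleftrightarrow> (\<exists>N. graded_submodule G R M Mg N \<and> C = chi G R Rg M Mg N)"
  shows "T = zariski_topology G R Rg M Mg"
proof -
  let ?S = "{Upsilon G R Rg M Mg - chi G R Rg M Mg N | N. graded_submodule G R M Mg N}"
  have opens: "openin T U \<longleftrightarrow> U \<in> ?S" for U
  proof
    assume U: "openin T U"
    then have "closedin T (topspace T - U)" by (rule openin_closedin_eq[THEN iffD1, THEN conjunct2])
    then obtain N where "graded_submodule G R M Mg N" "topspace T - U = chi G R Rg M Mg N"
      using closed[THEN iffD1] by blast
    moreover have "U = topspace T - (topspace T - U)"
      using openin_subset[OF U] by blast
    ultimately show "U \<in> ?S" unfolding top by blast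
  next
    assume "U \<in> ?S"
    then obtain N where N: "graded_submodule G R M Mg N" "U = topspace T - chi G R Rg M Mg N"
      unfolding top by blast
    then have "closedin T (chi G R Rg M Mg N)" using closed[THEN iffD2] by blast
    then show "openin T U" unfolding N(2) by (rule openin_diff[OF openin_topspace])
  qed
  have "openin T U \<longleftrightarrow> openin (topology_generated_by ?S) U" for U
  proof
    assume "openin T U"
    then show "openin (topology_generated_by ?S) U"
      by (intro topology_generated_by_Basis opens[THEN iffD1])
  next
    assume "openin (topology_generated_by ?S) U"
    then have "generate_topology_on ?S U"
      by (rule openin_topology_generated_by)
    then show "openin T U"
      by (rule generate_topology_on_coarsest[where T = "openin T", OF istopology_openin, rotated])
        (rule opens[THEN iffD2])
  qed
  then show ?thesis
    unfolding zariski_topology_def topology_eq by (rule allI)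
qed

section \<open>Irreducibility and generic points\<close>

definition irreducible_in :: "'a topology \<Rightarrow> 'a set \<Rightarrow> bool" where
  "irreducible_in T B \<longleftrightarrow> B \<subseteq> topspace T \<and> B \<noteq> {} \<and>
     \<not> (\<exists>C D. closedin (subtopology T B) C \<and> closedin (subtopology T B) D \<and>
              C \<subset> B \<and> D \<subset> B \<and> B = C \<union> D)"

definition irreducible_components :: "'a topology \<Rightarrow> 'a set set" where
  "irreducible_components T =
     {B. irreducible_in T B \<and> (\<forall>C. irreducible_in T C \<and> B \<subseteq> C \<longrightarrow> C = B)}"

definition generic_point :: "'a topology \<Rightarrow> 'a set \<Rightarrow> 'a \<Rightarrow> bool" where
  "generic_point T Y x \<longleftrightarrow> x \<in> Y \<and> Y = Abstract_Topology.closure_of T {x}"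

end

theory Submission
  imports Defs
begin

text \<open>A set \<open>chi P\<close> with \<open>P \<in> Upsilon\<close> is the closure of the point \<open>P\<close>
  (\<open>closure_singleton\<close>), so it is irreducible and closed with generic point \<open>P\<close>. More
  generally, the closure of an irreducible set \<open>B\<close> is \<open>chi (\<Inter>B)\<close>
  (\<open>closure_irreducible_eq_chi\<close>): a finite union of sets \<open>chi N\<close> that contains an irreducible
  set contains it already in one of its members, so among all closed sets only the subbasic ones
  matter.

  The heart of the matter is that \<open>\<Inter>B\<close> lies in \<open>Upsilon\<close> for every irreducible \<open>B\<close>
  (\<open>Inter_irreducible_in_Upsilon\<close>). If \<open>a\<close>, \<open>b\<close> are homogeneous and \<open>0 \<noteq> a b\<close> annihilates
  \<open>M\<close> modulo \<open>\<Inter>B\<close>, then every \<open>Q \<in> B\<close> has a weakly prime residual that contains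
  \<open>a b\<close>, hence \<open>a\<close> or \<open>b\<close>; that is, \<open>B\<close> is covered by the closed sets \<open>chi (a M)\<close> and
  \<open>chi (b M)\<close>, and irreducibility puts \<open>B\<close> inside one of them, so \<open>a M\<close> or \<open>b M\<close> is contained
  in \<open>\<Inter>B\<close>. Consequently the irreducible closed sets are the sets \<open>chi P\<close>. As \<open>chi\<close> reverses
  inclusion and is injective on \<open>Upsilon\<close>, the irreducible components are the \<open>chi P\<close> with \<open>P\<close>
  minimal (\<open>irreducible_components_eq\<close>), and \<open>\<Inter>\<close> is the inverse correspondence.

  For a pseudo weakly primeful module, let \<open>L\<close> be a graded weakly prime ideal that contains the
  annihilator. Then \<open>L / Ann M\<close> is graded weakly prime in \<open>R / Ann M\<close>
  (\<open>quot_image_graded_weakly_prime\<close>), so \<open>L\<close> is the residual of some \<open>P \<in> Upsilon\<close>. From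
  \<open>L M \<subseteq> P\<close> it follows that \<open>L\<close> is also the residual of \<open>L M\<close>, so \<open>L M \<in> Upsilon\<close>
  (\<open>primeful_prod\<close>). Hence \<open>L \<mapsto> L M\<close> and \<open>P \<mapsto> (P : M)\<close> match the minimal elements on both
  sides (\<open>primeful_minimal_elements\<close>).

  Gradedness is handled through homogeneous components: an additive subgroup is graded if and only
  if it contains the components of its elements (\<open>graded_iff_components\<close>).\<close>

section \<open>Homogeneous components\<close>

lemma finsum_in_additive_subgroup:
  assumes "abelian_group A" and P: "additive_subgroup P A" and c: "\<And>g. g \<in> F \<Longrightarrow> c g \<in> P"
  shows "finsum A c F \<in> P"
proof -
  interpret abelian_group A by fact
  interpret P: additive_subgroup P A by fact
  show ?thesis
    using c
  proof (induction F rule: infinite_finite_induct)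
    case (insert g F)
    then have "c \<in> F \<rightarrow> carrier A" "c g \<in> carrier A"
      using P.a_subset by auto
    with insert show ?case
      by (auto intro: P.a_closed)
  qed auto
qed

lemma additive_subgroup_Int:
  assumes "abelian_group A" "additive_subgroup P A" "additive_subgroup Q A"
  shows "additive_subgroup (P \<inter> Q) A"
proof -
  interpret abelian_group A by fact
  show ?thesis
    using assms(2,3) add.subgroups_Inter_pair unfolding additive_subgroup_def by blast
qed

lemma additive_subgroupI:
  assumes "abelian_group A" "P \<subseteq> carrier A" "\<zero>\<^bsub>A\<^esub> \<in> P"
    and "\<And>x. x \<in> P \<Longrightarrow> \<ominus>\<^bsub>A\<^esub> x \<in> P" "\<And>x y. x \<in> P \<Longrightarrow> y \<in> P \<Longrightarrow> x \<oplus>\<^bsub>A\<^esub> y \<in> P"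
  shows "additive_subgroup P A"
proof -
  interpret abelian_group A by fact
  show ?thesis
    using assms(2-5) by unfold_locales (auto simp: a_inv_def)
qed

text \<open>An introduction rule in which existence and uniqueness of decompositions are stated for
  sums over arbitrary finite index sets rather than over the exact support of a family on \<open>I\<close>.\<close>

lemma internal_direct_sumI:
  assumes A: "abelian_group A" and S: "\<And>g. g \<in> I \<Longrightarrow> additive_subgroup (S g) A"
    and Y: "additive_subgroup Y A" and SY: "\<And>g. g \<in> I \<Longrightarrow> S g \<subseteq> Y"
    and ex: "\<And>x. x \<in> Y \<Longrightarrow> \<exists>F c. finite F \<and> F \<subseteq> I \<and> (\<forall>g\<in>F. c g \<in> S g) \<and> x = finsum A c F"
    and zero: "\<And>F c g. \<lbrakk>finite F; F \<subseteq> I; \<And>g. g \<in> F \<Longrightarrow> c g \<in> S g; finsum A c F = \<zero>\<^bsub>A\<^esub>; g \<in> F\<rbrakk>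
      \<Longrightarrow> c g = \<zero>\<^bsub>A\<^esub>"
  shows "internal_direct_sum A I S Y"
proof -
  interpret abelian_group A by fact
  let ?supp = "\<lambda>c. {g \<in> I. c g \<noteq> \<zero>\<^bsub>A\<^esub>}"
  let ?fam = "{c \<in> (\<Pi>\<^sub>E g\<in>I. S g). finite (?supp c)}"
  have carr: "S g \<subseteq> carrier A" if "g \<in> I" for g
    using additive_subgroup.a_subset[OF S[OF that]] .
  have supp_sum: "finsum A c (?supp c) = finsum A c F"
    if c: "c \<in> ?fam" and F: "finite F" "F \<subseteq> I" "?supp c \<subseteq> F" for c F
  proof (rule add.finprod_mono_neutral_cong_left)
    show "c \<in> F \<rightarrow> carrier A"
    proof
      fix g assume "g \<in> F"
      then show "c g \<in> carrier A"
        using c F(2) carr[of g] by (auto dest: PiE_mem)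
    qed
    show "c g = \<zero>\<^bsub>A\<^esub>" if "g \<in> F - ?supp c" for g
      using that F(2) by auto
  qed (use F in simp_all)
  have "bij_betw (\<lambda>c. finsum A c (?supp c)) ?fam Y"
    unfolding bij_betw_def
  proof
    show "inj_on (\<lambda>c. finsum A c (?supp c)) ?fam"
    proof (rule inj_onI)
      fix c d assume c: "c \<in> ?fam" and d: "d \<in> ?fam"
        and eq: "finsum A c (?supp c) = finsum A d (?supp d)"
      let ?F = "?supp c \<union> ?supp d"
      have F: "finite ?F" "?F \<subseteq> I"
        using c d by auto
      have mem: "c g \<in> S g" "d g \<in> S g" if "g \<in> I" for g
        using c d that by (auto simp: PiE_iff)
      then have fcarr: "c \<in> ?F \<rightarrow> carrier A" "d \<in> ?F \<rightarrow> carrier A"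
        using carr by blast+
      have sums: "finsum A c ?F = finsum A d ?F"
        using eq supp_sum[OF c F] supp_sum[OF d F] by simp
      have "finsum A (\<lambda>g. \<ominus>\<^bsub>A\<^esub> d g) ?F \<oplus>\<^bsub>A\<^esub> finsum A d ?F
          = finsum A (\<lambda>g. \<ominus>\<^bsub>A\<^esub> d g \<oplus>\<^bsub>A\<^esub> d g) ?F"
        using fcarr by (intro finsum_addf[symmetric]) (auto simp: Pi_iff)
      also have "\<dots> = \<zero>\<^bsub>A\<^esub>"
        using fcarr by (intro add.finprod_one_eqI) (auto simp: Pi_iff l_neg)
      finally have "finsum A (\<lambda>g. c g \<oplus>\<^bsub>A\<^esub> \<ominus>\<^bsub>A\<^esub> d g) ?F = \<zero>\<^bsub>A\<^esub>"
        using fcarr sums a_comm[of "finsum A d ?F" "finsum A (\<lambda>g. \<ominus>\<^bsub>A\<^esub> d g) ?F"]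
        by (subst finsum_addf) (auto simp: Pi_iff)
      moreover have "c g \<oplus>\<^bsub>A\<^esub> \<ominus>\<^bsub>A\<^esub> d g \<in> S g" if "g \<in> ?F" for g
      proof -
        have "g \<in> I" using that by blast
        then interpret Sg: additive_subgroup "S g" A by (rule S)
        show ?thesis
          using mem[OF \<open>g \<in> I\<close>] by (intro Sg.a_closed Sg.a_inv_closed)
      qed
      ultimately have z: "c g \<oplus>\<^bsub>A\<^esub> \<ominus>\<^bsub>A\<^esub> d g = \<zero>\<^bsub>A\<^esub>" if "g \<in> ?F" for g
        using zero[OF F, of "\<lambda>g. c g \<oplus>\<^bsub>A\<^esub> \<ominus>\<^bsub>A\<^esub> d g"] that by blast
      show "c = d"
      proof
        fix g
        consider "g \<notin> I" | "g \<in> I" "g \<notin> ?F" | "g \<in> ?F" by blast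
        then show "c g = d g"
        proof cases
          case 1 then show ?thesis
            using c d by (auto simp: PiE_iff extensional_def)
        next
          case 2 then show ?thesis by auto
        next
          case 3
          then have "c g \<in> carrier A" "d g \<in> carrier A"
            using fcarr by blast+
          then show ?thesis
            using z[OF 3] minus_equality[of "c g" "\<ominus>\<^bsub>A\<^esub> d g"] by simp
        qed
      qed
    qed
    show "(\<lambda>c. finsum A c (?supp c)) ` ?fam = Y"
    proof (intro equalityI subsetI)
      fix x assume "x \<in> (\<lambda>c. finsum A c (?supp c)) ` ?fam"
      then show "x \<in> Y"
        using SY by (auto intro!: finsum_in_additive_subgroup[OF A Y] simp: PiE_iff)
    next
      fix x assume "x \<in> Y"
      then obtain F c where F: "finite F" "F \<subseteq> I" "\<forall>g\<in>F. c g \<in> S g" "x = finsum A c F"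
        using ex by blast
      define d where "d = (\<lambda>g\<in>I. if g \<in> F then c g else \<zero>\<^bsub>A\<^esub>)"
      have sub: "?supp d \<subseteq> F"
        by (auto simp: d_def split: if_splits)
      have d: "d \<in> ?fam"
        using F finite_subset[OF sub] additive_subgroup.zero_closed[OF S]
        by (auto simp: d_def PiE_iff)
      have "finsum A c F = finsum A d F"
      proof (rule finsum_cong')
        show "d \<in> F \<rightarrow> carrier A"
        proof
          fix g assume g: "g \<in> F"
          then have "c g \<in> S g" "g \<in> I"
            using F(2,3) by auto
          then show "d g \<in> carrier A"
            using g carr[of g] by (auto simp: d_def)
        qed
        show "c g = d g" if "g \<in> F" for g
          using that F(2) by (auto simp: d_def)
      qed simp
      then show "x \<in> (\<lambda>c. finsum A c (?supp c)) ` ?fam"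
        using d supp_sum[OF d F(1,2) sub] F(4) by (auto intro!: image_eqI[of _ _ d])
    qed
  qed
  then show ?thesis
    using S unfolding internal_direct_sum_def by blast
qed

text \<open>An abelian group with a direct sum decomposition, such as the additive group of a graded
  ring or of a graded module.\<close>

locale direct_sum_decomposition = abelian_group A
  for A :: "('a, 'r) ring_scheme" (structure) and I :: "'g set" and S :: "'g \<Rightarrow> 'a set" +
  assumes direct_sum: "internal_direct_sum A I S (carrier A)"
begin

text \<open>\<open>component x g\<close> is the component of \<open>x\<close> in \<open>S g\<close>. It is meaningful for
  \<open>x \<in> carrier A\<close> and \<open>g \<in> I\<close> only.\<close>

definition component :: "'a \<Rightarrow> 'g \<Rightarrow> 'a" where
  "component x = the_inv_into {c \<in> (\<Pi>\<^sub>E g\<in>I. S g). finite {g \<in> I. c g \<noteq> \<zero>}}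
     (\<lambda>c. finsum A c {g \<in> I. c g \<noteq> \<zero>}) x"

lemma summand_subgroup: "g \<in> I \<Longrightarrow> additive_subgroup (S g) A"
  using direct_sum by (auto simp: internal_direct_sum_def)

lemma summand_carrier: "g \<in> I \<Longrightarrow> x \<in> S g \<Longrightarrow> x \<in> carrier A"
  using additive_subgroup.a_subset[OF summand_subgroup] by blast

lemma component_family:
  assumes "x \<in> carrier A"
  shows "component x \<in> (\<Pi>\<^sub>E g\<in>I. S g)" "finite {g \<in> I. component x g \<noteq> \<zero>}"
    "finsum A (component x) {g \<in> I. component x g \<noteq> \<zero>} = x"
proof -
  let ?fam = "{c \<in> (\<Pi>\<^sub>E g\<in>I. S g). finite {g \<in> I. c g \<noteq> \<zero>}}"
  let ?sum = "\<lambda>c. finsum A c {g \<in> I. c g \<noteq> \<zero>}"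
  have bij: "bij_betw ?sum ?fam (carrier A)"
    using direct_sum by (simp add: internal_direct_sum_def)
  then have inj: "inj_on ?sum ?fam" and img: "x \<in> ?sum ` ?fam"
    using assms by (simp_all add: bij_betw_def)
  have "component x \<in> ?fam"
    unfolding component_def using the_inv_into_into[OF inj img subset_refl] .
  then show "component x \<in> (\<Pi>\<^sub>E g\<in>I. S g)" "finite {g \<in> I. component x g \<noteq> \<zero>}"
    by auto
  show "?sum (component x) = x"
    unfolding component_def using f_the_inv_into_f[OF inj img] .
qed

lemma component_mem: "x \<in> carrier A \<Longrightarrow> g \<in> I \<Longrightarrow> component x g \<in> S g"
  using component_family(1) by (auto simp: PiE_iff)

lemma component_carrier: "x \<in> carrier A \<Longrightarrow> g \<in> I \<Longrightarrow> component x g \<in> carrier A"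
  using component_mem summand_carrier by blast

lemma component_unique:
  assumes F: "finite F" "F \<subseteq> I" "\<And>g. g \<in> F \<Longrightarrow> c g \<in> S g" and g: "g \<in> I"
  shows "component (finsum A c F) g = (if g \<in> F then c g else \<zero>)"
proof -
  let ?fam = "{c \<in> (\<Pi>\<^sub>E g\<in>I. S g). finite {g \<in> I. c g \<noteq> \<zero>}}"
  let ?sum = "\<lambda>c. finsum A c {g \<in> I. c g \<noteq> \<zero>}"
  have inj: "inj_on ?sum ?fam"
    using direct_sum by (simp add: internal_direct_sum_def bij_betw_def)
  define d where "d = (\<lambda>g\<in>I. if g \<in> F then c g else \<zero>)"
  have sub: "{g \<in> I. d g \<noteq> \<zero>} \<subseteq> F"
    by (auto simp: d_def split: if_splits)
  have d: "d \<in> ?fam"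
    using F finite_subset[OF sub] additive_subgroup.zero_closed[OF summand_subgroup]
    by (auto simp: d_def PiE_iff)
  have "?sum d = finsum A c F"
    by (rule add.finprod_mono_neutral_cong_left)
      (use F sub in \<open>auto simp: d_def intro: summand_carrier split: if_splits\<close>)
  then have "component (finsum A c F) = d"
    unfolding component_def using the_inv_into_f_f[OF inj d] by simp
  then show ?thesis
    using g by (simp add: d_def)
qed

lemma component_sum:
  assumes x: "x \<in> carrier A" and F: "finite F" "F \<subseteq> I" "{g \<in> I. component x g \<noteq> \<zero>} \<subseteq> F"
  shows "finsum A (component x) F = x"
proof -
  have "finsum A (component x) {g \<in> I. component x g \<noteq> \<zero>} = finsum A (component x) F"
    by (rule add.finprod_mono_neutral_cong_left) (use F component_carrier[OF x] in auto)
  then show ?thesis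
    using component_family(3)[OF x] by simp
qed

lemma component_add:
  assumes "x \<in> carrier A" "y \<in> carrier A" "g \<in> I"
  shows "component (x \<oplus> y) g = component x g \<oplus> component y g"
proof -
  define F where "F = {g \<in> I. component x g \<noteq> \<zero>} \<union> {g \<in> I. component y g \<noteq> \<zero>} \<union> {g}"
  have F: "finite F" "F \<subseteq> I" "g \<in> F"
    using component_family(2) assms by (auto simp: F_def)
  have "finsum A (component x) F = x" "finsum A (component y) F = y"
    using F assms by (auto intro!: component_sum simp: F_def)
  then have "x \<oplus> y = finsum A (component x) F \<oplus> finsum A (component y) F"
    by simp
  also have "\<dots> = finsum A (\<lambda>g. component x g \<oplus> component y g) F"
    by (rule finsum_addf[symmetric]) (use F component_carrier assms in blast)+
  finally have sum: "x \<oplus> y = finsum A (\<lambda>g. component x g \<oplus> component y g) F" .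
  have "component x h \<oplus> component y h \<in> S h" if "h \<in> F" for h
    using that F(2) component_mem assms additive_subgroup.a_closed[OF summand_subgroup] by blast
  then show ?thesis
    unfolding sum using component_unique[OF F(1,2), of "\<lambda>g. component x g \<oplus> component y g"]
      F(3) assms(3) by simp
qed

lemma component_homogeneous:
  assumes "h \<in> I" "x \<in> S h" "g \<in> I"
  shows "component x g = (if g = h then x else \<zero>)"
  using component_unique[of "{h}" "\<lambda>_. x" g] assms summand_carrier by simp

lemma component_zero: "g \<in> I \<Longrightarrow> component \<zero> g = \<zero>"
  using component_unique[of "{}"] by simp

lemma component_minus:
  assumes "x \<in> carrier A" "g \<in> I"
  shows "component (\<ominus> x) g = \<ominus> component x g"
  using component_add[of "\<ominus> x" x g] assms
  by (simp add: l_neg component_zero component_carrier minus_equality)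

lemma subgroup_component_preimage:
  assumes "additive_subgroup K A"
  shows "additive_subgroup {x \<in> carrier A. \<forall>g\<in>I. component x g \<in> K} A"
proof -
  interpret K: additive_subgroup K A by fact
  show ?thesis
    by (rule additive_subgroupI)
      (auto simp: component_zero component_minus component_add K.a_inv_closed
        intro: abelian_group_axioms)
qed

text \<open>To prove for all elements a property that defines an additive subgroup, it suffices to
  prove it for the homogeneous ones.\<close>

lemma carrier_subset_of_homogeneous:
  assumes K: "additive_subgroup K A" and S: "\<And>g. g \<in> I \<Longrightarrow> S g \<subseteq> K"
  shows "carrier A \<subseteq> K"
proof
  fix x assume x: "x \<in> carrier A"
  have "finsum A (component x) {g \<in> I. component x g \<noteq> \<zero>} \<in> K"
    by (rule finsum_in_additive_subgroup[OF abelian_group_axioms K])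
      (use S component_mem[OF x] in blast)
  then show "x \<in> K"
    using component_family(3)[OF x] by simp
qed

text \<open>Uniqueness of decompositions is inherited by subgroups, so the gradedness of \<open>P\<close> only
  asks that \<open>P\<close> contain the homogeneous components of its elements.\<close>

lemma graded_iff_components:
  assumes P: "additive_subgroup P A"
  shows "internal_direct_sum A I (\<lambda>g. P \<inter> S g) P \<longleftrightarrow> (\<forall>x\<in>P. \<forall>g\<in>I. component x g \<in> P)"
proof
  assume "internal_direct_sum A I (\<lambda>g. P \<inter> S g) P"
  then have bij: "bij_betw (\<lambda>c. finsum A c {g \<in> I. c g \<noteq> \<zero>})
      {c \<in> (\<Pi>\<^sub>E g\<in>I. P \<inter> S g). finite {g \<in> I. c g \<noteq> \<zero>}} P"
    by (simp add: internal_direct_sum_def)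
  show "\<forall>x\<in>P. \<forall>g\<in>I. component x g \<in> P"
  proof (intro ballI)
    fix x g assume "x \<in> P" and g: "g \<in> I"
    then obtain c where c: "c \<in> (\<Pi>\<^sub>E g\<in>I. P \<inter> S g)" "finite {g \<in> I. c g \<noteq> \<zero>}"
        "x = finsum A c {g \<in> I. c g \<noteq> \<zero>}"
      using bij by (auto simp: bij_betw_def)
    have "component x g = (if g \<in> {g \<in> I. c g \<noteq> \<zero>} then c g else \<zero>)"
      unfolding c(3) by (rule component_unique) (use c g in \<open>auto simp: PiE_iff\<close>)
    then show "component x g \<in> P"
      using c(1) g additive_subgroup.zero_closed[OF P] by (auto simp: PiE_iff)
  qed
next
  assume cl: "\<forall>x\<in>P. \<forall>g\<in>I. component x g \<in> P"
  show "internal_direct_sum A I (\<lambda>g. P \<inter> S g) P"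
  proof (rule internal_direct_sumI)
    fix x assume x: "x \<in> P"
    then have carr: "x \<in> carrier A"
      using additive_subgroup.a_subset[OF P] by blast
    show "\<exists>F c. finite F \<and> F \<subseteq> I \<and> (\<forall>g\<in>F. c g \<in> P \<inter> S g) \<and> x = finsum A c F"
      using cl x component_mem[OF carr] component_family(2,3)[OF carr]
      by (intro exI[of _ "{g \<in> I. component x g \<noteq> \<zero>}"] exI[of _ "component x"]) auto
  next
    fix F c g assume *: "finite F" "F \<subseteq> I" "\<And>g. g \<in> F \<Longrightarrow> c g \<in> P \<inter> S g"
      "finsum A c F = \<zero>" "g \<in> F"
    then show "c g = \<zero>"
      using component_unique[of F c g] component_zero[of g] by auto
  qed (auto intro: P additive_subgroup_Int abelian_group_axioms summand_subgroup)
qed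

end

section \<open>Irreducible subsets of a topological space\<close>

lemma irreducible_in_closed_cover:
  assumes "irreducible_in T B" "closedin T C" "closedin T D" "B \<subseteq> C \<union> D"
  shows "B \<subseteq> C \<or> B \<subseteq> D"
proof -
  have "closedin (subtopology T B) (B \<inter> C)" "closedin (subtopology T B) (B \<inter> D)"
    using assms(2,3) by (auto simp: closedin_subtopology)
  moreover have "B = (B \<inter> C) \<union> (B \<inter> D)"
    using assms(4) by blast
  ultimately show ?thesis
    using assms(1) unfolding irreducible_in_def by (metis inf.cobounded1 inf.orderI psubsetI)
qed

lemma irreducible_in_closedI:
  assumes "closedin T B" "B \<noteq> {}"
    and "\<And>C D. closedin T C \<Longrightarrow> closedin T D \<Longrightarrow> B = C \<union> D \<Longrightarrow> B \<subseteq> C \<or> B \<subseteq> D"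
  shows "irreducible_in T B"
  using assms closedin_trans_full[OF _ assms(1)] closedin_subset[OF assms(1)]
  unfolding irreducible_in_def by (metis leD)

lemma irreducible_in_closure:
  assumes B: "irreducible_in T B"
  shows "irreducible_in T (Abstract_Topology.closure_of T B)"
proof (rule irreducible_in_closedI)
  have sub: "B \<subseteq> Abstract_Topology.closure_of T B"
    using B closure_of_subset unfolding irreducible_in_def by blast
  then show "Abstract_Topology.closure_of T B \<noteq> {}"
    using B unfolding irreducible_in_def by blast
  fix C D assume "closedin T C" "closedin T D" "Abstract_Topology.closure_of T B = C \<union> D"
  then show "Abstract_Topology.closure_of T B \<subseteq> C \<or> Abstract_Topology.closure_of T B \<subseteq> D"
    using irreducible_in_closed_cover[OF B, of C D] sub closure_of_minimal by metis
qed simp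

lemma irreducible_in_singleton: "x \<in> topspace T \<Longrightarrow> irreducible_in T {x}"
  unfolding irreducible_in_def by auto

text \<open>An irreducible set can be separated from a point outside its closure by a subbasic open
  set: if an intersection of two open sets misses \<open>B\<close>, then one of the two does.\<close>

lemma irreducible_in_subbasis:
  assumes B: "irreducible_in (topology_generated_by \<S>) B"
    and U: "openin (topology_generated_by \<S>) U" and "U \<inter> B = {}" "x \<in> U"
  shows "\<exists>V\<in>\<S>. x \<in> V \<and> V \<inter> B = {}"
proof -
  have "generate_topology_on \<S> U"
    using U by (rule openin_topology_generated_by)
  then show ?thesis
    using assms(3,4)
  proof (induction U)
    case (Int U V)
    let ?T = "topology_generated_by \<S>"
    have "closedin ?T (topspace ?T - U)" "closedin ?T (topspace ?T - V)"
      using Int.hyps by (auto simp: openin_topology_generated_by_iff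
          simp del: topology_generated_by_topspace intro!: openin_closedin_eq[THEN iffD1, THEN conjunct2])
    moreover have "B \<subseteq> (topspace ?T - U) \<union> (topspace ?T - V)"
      using Int.prems B unfolding irreducible_in_def by blast
    ultimately have "B \<subseteq> topspace ?T - U \<or> B \<subseteq> topspace ?T - V"
      using irreducible_in_closed_cover[OF B] by blast
    then show ?case
      using Int by blast
  qed blast+
qed

section \<open>Graded ideals and submodules\<close>

context graded_ring
begin

sublocale R_grading: direct_sum_decomposition R "carrier G" Rg
  by unfold_locales (rule ring_direct_sum)

lemma graded_ideal_iff:
  "graded_ideal G R Rg J \<longleftrightarrow>
    ideal J R \<and> (\<forall>r\<in>J. \<forall>g\<in>carrier G. R_grading.component r g \<in> J)"
  using R_grading.graded_iff_components[of J] ideal.axioms(1)[of J R]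
  unfolding graded_ideal_def by blast

lemma graded_ideal_subset: "graded_ideal G R Rg J \<Longrightarrow> J \<subseteq> carrier R"
  by (simp add: graded_ideal_def ideal.axioms(1) additive_subgroup.a_subset)

end

context graded_module
begin

sublocale M_grading: direct_sum_decomposition M "carrier G" Mg
  by unfold_locales (rule module_direct_sum)

lemma submodule_additive_subgroup: "submodule P R M \<Longrightarrow> additive_subgroup P M"
  by (simp add: additive_subgroup_def submodule_def)

lemma graded_submodule_iff:
  "graded_submodule G R M Mg P \<longleftrightarrow>
    submodule P R M \<and> (\<forall>x\<in>P. \<forall>g\<in>carrier G. M_grading.component x g \<in> P)"
  using M_grading.graded_iff_components[of P] submodule_additive_subgroup[of P]
  unfolding graded_submodule_def by blast

text \<open>Only the homogeneous part of \<open>r\<close> of degree \<open>g\<close> contributes to \<open>r x\<close> in degree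
  \<open>g h\<close>, because \<open>k h = g h\<close> forces \<open>k = g\<close> in a group. Both sides being additive in \<open>r\<close>, it
  suffices to check this for homogeneous \<open>r\<close>.\<close>

lemma component_smult:
  assumes r: "r \<in> carrier R" and g: "g \<in> carrier G" and h: "h \<in> carrier G" and x: "x \<in> Mg h"
  shows "M_grading.component (r \<odot>\<^bsub>M\<^esub> x) (g \<otimes>\<^bsub>G\<^esub> h) = R_grading.component r g \<odot>\<^bsub>M\<^esub> x"
proof -
  let ?K = "{r \<in> carrier R.
    M_grading.component (r \<odot>\<^bsub>M\<^esub> x) (g \<otimes>\<^bsub>G\<^esub> h) = R_grading.component r g \<odot>\<^bsub>M\<^esub> x}"
  have xM: "x \<in> carrier M"
    using M_grading.summand_carrier[OF h x] .
  have gh: "g \<otimes>\<^bsub>G\<^esub> h \<in> carrier G"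
    using g h by simp
  have "additive_subgroup ?K R"
  proof (rule additive_subgroupI)
    show "\<zero> \<in> ?K"
      using xM g gh by (simp add: R_grading.component_zero M_grading.component_zero)
    show "\<ominus> r \<in> ?K" if "r \<in> ?K" for r
      using that xM g gh by (simp add: smult_l_minus R_grading.component_minus
          M_grading.component_minus R_grading.component_carrier)
    show "r \<oplus> s \<in> ?K" if "r \<in> ?K" "s \<in> ?K" for r s
      using that xM g gh by (simp add: smult_l_distr R_grading.component_add
          M_grading.component_add R_grading.component_carrier)
  qed (auto intro: is_abelian_group)
  moreover have "Rg k \<subseteq> ?K" if k: "k \<in> carrier G" for k
  proof
    fix r assume r: "r \<in> Rg k"
    have "r \<odot>\<^bsub>M\<^esub> x \<in> Mg (k \<otimes>\<^bsub>G\<^esub> h)"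
      using module_smult[OF k h r x] .
    moreover have "g \<otimes>\<^bsub>G\<^esub> h = k \<otimes>\<^bsub>G\<^esub> h \<longleftrightarrow> g = k"
      using g h k by simp
    ultimately show "r \<in> ?K"
      using r k g gh h xM R_grading.summand_carrier[OF k r]
      by (simp add: R_grading.component_homogeneous[OF k r]
          M_grading.component_homogeneous[of "k \<otimes>\<^bsub>G\<^esub> h"])
  qed
  ultimately show ?thesis
    using R_grading.carrier_subset_of_homogeneous r by blast
qed

lemma carrier_subset_of_homogeneous_smult:
  assumes P: "additive_subgroup P M" and r: "r \<in> carrier R"
    and hom: "\<And>h x. h \<in> carrier G \<Longrightarrow> x \<in> Mg h \<Longrightarrow> r \<odot>\<^bsub>M\<^esub> x \<in> P" and x: "x \<in> carrier M"
  shows "r \<odot>\<^bsub>M\<^esub> x \<in> P"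
proof -
  interpret P: additive_subgroup P M by fact
  have "additive_subgroup {x \<in> carrier M. r \<odot>\<^bsub>M\<^esub> x \<in> P} M"
    by (rule additive_subgroupI)
      (use r in \<open>auto simp: smult_r_minus smult_r_distr intro: M.abelian_group_axioms\<close>)
  then show ?thesis
    using M_grading.carrier_subset_of_homogeneous M_grading.summand_carrier hom x by blast
qed

lemma residual_ideal:
  assumes "submodule P R M"
  shows "ideal (residual R M P) R"
proof -
  interpret P: additive_subgroup P M
    using assms by (rule submodule_additive_subgroup)
  have "additive_subgroup (residual R M P) R"
    by (rule additive_subgroupI)
      (auto simp: residual_def smult_l_minus smult_l_distr
        intro: is_abelian_group)
  then show ?thesis
    by (intro idealI additive_subgroup.a_subgroup ring_axioms)
      (auto simp: residual_def smult_assoc1 submoduleE(4)[OF assms])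
qed

lemma residual_graded_ideal:
  assumes "graded_submodule G R M Mg P"
  shows "graded_ideal G R Rg (residual R M P)"
proof -
  have P: "submodule P R M" and comp: "\<And>x g. x \<in> P \<Longrightarrow> g \<in> carrier G \<Longrightarrow> M_grading.component x g \<in> P"
    using assms by (auto simp: graded_submodule_iff)
  have "R_grading.component r g \<odot>\<^bsub>M\<^esub> x \<in> P"
    if r: "r \<in> residual R M P" and g: "g \<in> carrier G" and x: "x \<in> carrier M" for r g x
  proof (rule carrier_subset_of_homogeneous_smult[OF submodule_additive_subgroup[OF P] _ _ x])
    have rR: "r \<in> carrier R"
      using r by (simp add: residual_def)
    then show "R_grading.component r g \<in> carrier R"
      using g by (rule R_grading.component_carrier)
    fix h y assume h: "h \<in> carrier G" and y: "y \<in> Mg h"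
    have "r \<odot>\<^bsub>M\<^esub> y \<in> P"
      using r M_grading.summand_carrier[OF h y] by (simp add: residual_def)
    then show "R_grading.component r g \<odot>\<^bsub>M\<^esub> y \<in> P"
      using comp[of "r \<odot>\<^bsub>M\<^esub> y" "g \<otimes>\<^bsub>G\<^esub> h"] component_smult[OF rR g h y] g h by simp
  qed
  then show ?thesis
    using residual_ideal[OF P] R_grading.component_carrier
    by (auto simp: graded_ideal_iff residual_def)
qed

lemma graded_submodule_Inter:
  assumes "\<S> \<noteq> {}" and P: "\<And>P. P \<in> \<S> \<Longrightarrow> graded_submodule G R M Mg P"
  shows "graded_submodule G R M Mg (\<Inter>\<S>)"
proof -
  have sub: "submodule P R M" if "P \<in> \<S>" for P
    using P[OF that] by (simp add: graded_submodule_iff)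
  have "submodule (\<Inter>\<S>) R M"
  proof (rule submoduleI)
    show "\<Inter>\<S> \<subseteq> carrier M"
      using assms(1) submoduleE(1)[OF sub] by blast
    show "\<zero>\<^bsub>M\<^esub> \<in> \<Inter>\<S>"
      using additive_subgroup.zero_closed[OF submodule_additive_subgroup[OF sub]] by blast
  qed (auto intro: submoduleE(3,4,5)[OF sub])
  then show ?thesis
    using P by (auto simp: graded_submodule_iff)
qed

lemma zero_graded_submodule: "graded_submodule G R M Mg {\<zero>\<^bsub>M\<^esub>}"
  unfolding graded_submodule_iff
  by (auto simp: M_grading.component_zero intro!: submoduleI)

lemma carrier_graded_submodule: "graded_submodule G R M Mg (carrier M)"
  using carrier_is_submodule M_grading.component_carrier by (simp add: graded_submodule_iff)

lemma ideal_module_prod_subset_iff: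
  assumes L: "L \<subseteq> carrier R" and P: "submodule P R M"
  shows "ideal_module_prod M L \<subseteq> P \<longleftrightarrow> L \<subseteq> residual R M P"
proof
  let ?X = "{l \<odot>\<^bsub>M\<^esub> x | l x. l \<in> L \<and> x \<in> carrier M}"
  assume *: "ideal_module_prod M L \<subseteq> P"
  have "?X \<subseteq> ideal_module_prod M L"
    unfolding ideal_module_prod_def by (intro subsetI generate.incl)
  then show "L \<subseteq> residual R M P"
    using * L by (auto simp: residual_def)
next
  assume "L \<subseteq> residual R M P"
  then show "ideal_module_prod M L \<subseteq> P"
    unfolding ideal_module_prod_def
    by (intro M.add.generate_subgroup_incl submodule.axioms(1)[OF P]) (auto simp: residual_def)
qed

text \<open>The set \<open>L\<close> need not be an ideal: besides graded ideals, the lemma covers \<open>L = {a, 0}\<close>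
  with \<open>a\<close> homogeneous, for which \<open>L M\<close> is \<open>a M\<close>.\<close>

lemma ideal_module_prod_graded:
  assumes L: "L \<subseteq> carrier R"
    and comp: "\<And>l g. l \<in> L \<Longrightarrow> g \<in> carrier G \<Longrightarrow> R_grading.component l g \<in> L"
  shows "graded_submodule G R M Mg (ideal_module_prod M L)"
proof -
  let ?X = "{l \<odot>\<^bsub>M\<^esub> x | l x. l \<in> L \<and> x \<in> carrier M}"
  let ?N = "ideal_module_prod M L"
  have X: "?X \<subseteq> carrier M"
    using L by auto
  have N: "additive_subgroup ?N M"
    unfolding ideal_module_prod_def using M.add.generate_is_subgroup X
    by (simp add: additive_subgroup_def)
  interpret N: additive_subgroup ?N M by fact
  have XN: "l \<odot>\<^bsub>M\<^esub> x \<in> ?N" if "l \<in> L" "x \<in> carrier M" for l x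
    unfolding ideal_module_prod_def using that by (intro generate.incl) auto
  have N_min: "?N \<subseteq> K" if "additive_subgroup K M" "\<And>l x. l \<in> L \<Longrightarrow> x \<in> carrier M \<Longrightarrow> l \<odot>\<^bsub>M\<^esub> x \<in> K" for K
    unfolding ideal_module_prod_def
    by (rule M.add.generate_subgroup_incl) (use that in \<open>auto simp: additive_subgroup_def\<close>)
  have smult: "r \<odot>\<^bsub>M\<^esub> y \<in> ?N" if r: "r \<in> carrier R" and y: "y \<in> ?N" for r y
  proof -
    have "additive_subgroup {y \<in> carrier M. r \<odot>\<^bsub>M\<^esub> y \<in> ?N} M"
      by (rule additive_subgroupI)
        (use r in \<open>auto simp: smult_r_minus smult_r_distr intro: M.abelian_group_axioms\<close>)
    moreover have "r \<odot>\<^bsub>M\<^esub> (l \<odot>\<^bsub>M\<^esub> x) \<in> ?N" if "l \<in> L" "x \<in> carrier M" for l x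
    proof -
      have "r \<odot>\<^bsub>M\<^esub> (l \<odot>\<^bsub>M\<^esub> x) = l \<odot>\<^bsub>M\<^esub> (r \<odot>\<^bsub>M\<^esub> x)"
        using that L r smult_assoc1[of r l x] smult_assoc1[of l r x] m_comm[of r l] by auto
      then show ?thesis
        using XN that r by simp
    qed
    ultimately have "?N \<subseteq> {y \<in> carrier M. r \<odot>\<^bsub>M\<^esub> y \<in> ?N}"
      using subsetD[OF L] by (intro N_min) auto
    then show ?thesis
      using y by blast
  qed
  have sub: "submodule ?N R M"
    using N.a_subset smult by (intro submoduleI) auto
  let ?D = "{y \<in> carrier M. \<forall>g\<in>carrier G. M_grading.component y g \<in> ?N}"
  have D: "additive_subgroup ?D M"
    using N by (rule M_grading.subgroup_component_preimage)
  have "?N \<subseteq> ?D"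
  proof (rule N_min[OF D])
    fix l x assume l: "l \<in> L" and x: "x \<in> carrier M"
    then have lR: "l \<in> carrier R"
      using L by blast
    show "l \<odot>\<^bsub>M\<^esub> x \<in> ?D"
    proof (rule carrier_subset_of_homogeneous_smult[OF D lR _ x])
      fix h y assume h: "h \<in> carrier G" and y: "y \<in> Mg h"
      have yM: "y \<in> carrier M"
        using M_grading.summand_carrier[OF h y] .
      have "M_grading.component (l \<odot>\<^bsub>M\<^esub> y) k \<in> ?N" if k: "k \<in> carrier G" for k
      proof -
        have "k \<otimes>\<^bsub>G\<^esub> inv\<^bsub>G\<^esub> h \<otimes>\<^bsub>G\<^esub> h = k"
          using h k by (simp add: grp.m_assoc)
        then have "M_grading.component (l \<odot>\<^bsub>M\<^esub> y) k = R_grading.component l (k \<otimes>\<^bsub>G\<^esub> inv\<^bsub>G\<^esub> h) \<odot>\<^bsub>M\<^esub> y"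
          using component_smult[OF lR _ h y, of "k \<otimes>\<^bsub>G\<^esub> inv\<^bsub>G\<^esub> h"] h k by simp
        then show ?thesis
          using XN comp l yM h k by simp
      qed
      then show "l \<odot>\<^bsub>M\<^esub> y \<in> ?D"
        using lR yM by simp
    qed
  qed
  then show ?thesis
    using sub by (auto simp: graded_submodule_iff)
qed

section \<open>Irreducible closed sets of the Zariski topology\<close>

text \<open>The space of graded pseudo weakly prime submodules, the sets \<open>chi N\<close> and the Zariski
  topology of the fixed module.\<close>

abbreviation "\<Y> \<equiv> Upsilon G R Rg M Mg"
abbreviation "\<C> \<equiv> chi G R Rg M Mg"
abbreviation "\<T> \<equiv> zariski_topology G R Rg M Mg"

lemma Upsilon_graded: "P \<in> \<Y> \<Longrightarrow> graded_submodule G R M Mg P"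
  by (simp add: Upsilon_def)

lemma Upsilon_submodule: "P \<in> \<Y> \<Longrightarrow> submodule P R M"
  using Upsilon_graded by (simp add: graded_submodule_iff)

lemma chi_subset: "\<C> N \<subseteq> \<Y>"
  by (auto simp: chi_def)

lemma chi_carrier: "\<C> (carrier M) = {}"
proof -
  have "\<not> carrier M \<subseteq> P" if P: "P \<in> \<Y>" for P
  proof
    assume "carrier M \<subseteq> P"
    then have "residual R M P = carrier R"
      by (auto simp: residual_def)
    then show False
      using P by (simp add: Upsilon_def graded_weakly_prime_def)
  qed
  then show ?thesis
    by (auto simp: chi_def)
qed

lemma topspace_zariski: "topspace \<T> = \<Y>"
proof -
  have "\<Y> - \<C> (carrier M) \<in> {\<Y> - \<C> N | N. graded_submodule G R M Mg N}"
    using carrier_graded_submodule by blast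
  then have "\<Y> \<subseteq> topspace \<T>"
    unfolding zariski_topology_def topology_generated_by_topspace chi_carrier by blast
  moreover have "topspace \<T> \<subseteq> \<Y>"
    unfolding zariski_topology_def topology_generated_by_topspace by blast
  ultimately show ?thesis by blast
qed

lemma closedin_chi:
  assumes "graded_submodule G R M Mg N"
  shows "closedin \<T> (\<C> N)"
proof -
  have "openin \<T> (\<Y> - \<C> N)"
    unfolding zariski_topology_def by (rule topology_generated_by_Basis) (use assms in blast)
  then show ?thesis
    using chi_subset by (simp add: closedin_def topspace_zariski)
qed

lemma closure_irreducible_eq_chi:
  assumes "irreducible_in \<T> B"
  shows "Abstract_Topology.closure_of \<T> B = \<C> (\<Inter>B)"
proof -
  have B: "B \<subseteq> \<Y>" "B \<noteq> {}"
    using assms topspace_zariski by (auto simp: irreducible_in_def)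
  have "graded_submodule G R M Mg (\<Inter>B)"
    using B Upsilon_graded by (intro graded_submodule_Inter) auto
  then have "Abstract_Topology.closure_of \<T> B \<subseteq> \<C> (\<Inter>B)"
    using B by (intro closure_of_minimal closedin_chi) (auto simp: chi_def)
  moreover have "Q \<in> Abstract_Topology.closure_of \<T> B" if Q: "Q \<in> \<C> (\<Inter>B)" for Q
  proof (rule ccontr)
    assume "Q \<notin> Abstract_Topology.closure_of \<T> B"
    then obtain U where U: "openin \<T> U" "Q \<in> U" "U \<inter> B = {}"
      using Q chi_subset by (auto simp: closure_of_def topspace_zariski)
    then obtain V where V: "V \<in> {\<Y> - \<C> N | N. graded_submodule G R M Mg N}" "Q \<in> V" "V \<inter> B = {}"
      using irreducible_in_subbasis[OF assms[unfolded zariski_topology_def]]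
      unfolding zariski_topology_def by meson
    then obtain N where "Q \<in> \<Y> - \<C> N" "(\<Y> - \<C> N) \<inter> B = {}"
      by auto
    then have "B \<subseteq> \<C> N" "\<not> N \<subseteq> Q"
      using B by (auto simp: chi_def)
    then show False
      using Q by (auto simp: chi_def)
  qed
  ultimately show ?thesis by blast
qed

lemma closure_singleton: "P \<in> \<Y> \<Longrightarrow> Abstract_Topology.closure_of \<T> {P} = \<C> P"
  using closure_irreducible_eq_chi[OF irreducible_in_singleton] by (simp add: topspace_zariski)

lemma irreducible_chi: "P \<in> \<Y> \<Longrightarrow> irreducible_in \<T> (\<C> P)"
  using irreducible_in_closure[OF irreducible_in_singleton, of P \<T>] closure_singleton[of P]
  by (simp add: topspace_zariski)

text \<open>In general an intersection of graded pseudo weakly prime submodules is not pseudo weakly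
  prime; irreducibility of the family is what makes the primality condition survive.\<close>

lemma Inter_irreducible_in_Upsilon:
  assumes "irreducible_in \<T> B"
  shows "\<Inter>B \<in> \<Y>"
proof -
  have B: "B \<subseteq> \<Y>" "B \<noteq> {}"
    using assms topspace_zariski by (auto simp: irreducible_in_def)
  have graded: "graded_submodule G R M Mg (\<Inter>B)"
    using B Upsilon_graded by (intro graded_submodule_Inter) auto
  have res: "residual R M (\<Inter>B) = (\<Inter>Q\<in>B. residual R M Q)"
    using B(2) by (auto simp: residual_def)
  have "residual R M (\<Inter>B) \<noteq> carrier R"
  proof -
    obtain Q where Q: "Q \<in> B"
      using B by blast
    then have "residual R M Q \<noteq> carrier R" "residual R M Q \<subseteq> carrier R"
      using B by (auto simp: Upsilon_def graded_weakly_prime_def residual_def)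
    then show ?thesis
      using Q res by blast
  qed
  moreover have "a \<in> residual R M (\<Inter>B) \<or> b \<in> residual R M (\<Inter>B)"
    if a: "a \<in> homogeneous_elements G Rg" and b: "b \<in> homogeneous_elements G Rg"
      and ab: "a \<otimes> b \<noteq> \<zero>" "a \<otimes> b \<in> residual R M (\<Inter>B)" for a b
  proof -
    \<comment> \<open>\<open>{a, 0}\<close> is closed under homogeneous components while \<open>{a}\<close> is not.\<close>
    let ?aM = "\<lambda>a. ideal_module_prod M {a, \<zero>}"
    have aM: "closedin \<T> (\<C> (?aM a))" "\<And>Q. Q \<in> \<Y> \<Longrightarrow> Q \<in> \<C> (?aM a) \<longleftrightarrow> a \<in> residual R M Q"
      if a: "a \<in> homogeneous_elements G Rg" for a
    proof -
      obtain h where h: "h \<in> carrier G" "a \<in> Rg h"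
        using a by (auto simp: homogeneous_elements_def)
      then have aR: "{a, \<zero>} \<subseteq> carrier R"
        using R_grading.summand_carrier by simp
      moreover have "R_grading.component l g \<in> {a, \<zero>}" if "l \<in> {a, \<zero>}" "g \<in> carrier G" for l g
        using that h by (auto simp: R_grading.component_homogeneous R_grading.component_zero)
      ultimately show "closedin \<T> (\<C> (?aM a))"
        by (intro closedin_chi ideal_module_prod_graded) auto
      show "Q \<in> \<C> (?aM a) \<longleftrightarrow> a \<in> residual R M Q" if Q: "Q \<in> \<Y>" for Q
      proof -
        have "\<zero> \<in> residual R M Q"
          using residual_ideal[OF Upsilon_submodule[OF Q]]
          by (simp add: additive_subgroup.zero_closed ideal.axioms(1))
        then show ?thesis
          using Q ideal_module_prod_subset_iff[OF aR Upsilon_submodule[OF Q]]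
          by (auto simp: chi_def)
      qed
    qed
    have "B \<subseteq> \<C> (?aM a) \<union> \<C> (?aM b)"
    proof
      fix Q assume Q: "Q \<in> B"
      then have "Q \<in> \<Y>" "a \<otimes> b \<in> residual R M Q"
        using B ab(2) res by auto
      then have "a \<in> residual R M Q \<or> b \<in> residual R M Q"
        using a b ab(1) by (auto simp: Upsilon_def graded_weakly_prime_def)
      then show "Q \<in> \<C> (?aM a) \<union> \<C> (?aM b)"
        using aM(2) a b \<open>Q \<in> \<Y>\<close> by blast
    qed
    then have "B \<subseteq> \<C> (?aM a) \<or> B \<subseteq> \<C> (?aM b)"
      using irreducible_in_closed_cover[OF assms aM(1)[OF a] aM(1)[OF b]] by blast
    moreover have "B \<subseteq> \<C> (?aM a) \<longleftrightarrow> a \<in> residual R M (\<Inter>B)"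
      if "a \<in> homogeneous_elements G Rg" for a
      unfolding res using aM(2)[OF that] B(1) by auto
    ultimately show ?thesis
      using a b by blast
  qed
  ultimately show ?thesis
    using graded residual_graded_ideal[OF graded]
    by (auto simp: Upsilon_def graded_weakly_prime_def)
qed

lemma irreducible_closed_iff:
  "irreducible_in \<T> B \<and> closedin \<T> B \<longleftrightarrow> (\<exists>P\<in>\<Y>. B = \<C> P)"
proof
  assume B: "irreducible_in \<T> B \<and> closedin \<T> B"
  then have "B = \<C> (\<Inter>B)"
    using closure_irreducible_eq_chi[of B] closure_of_closedin[of \<T> B] by simp
  then show "\<exists>P\<in>\<Y>. B = \<C> P"
    using B Inter_irreducible_in_Upsilon[of B] by blast
qed (auto intro: irreducible_chi closedin_chi Upsilon_graded)

lemma chi_subset_chi_iff: "P \<in> \<Y> \<Longrightarrow> Q \<in> \<Y> \<Longrightarrow> \<C> P \<subseteq> \<C> Q \<longleftrightarrow> Q \<subseteq> P"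
  by (auto simp: chi_def)

lemma Inter_chi: "P \<in> \<Y> \<Longrightarrow> \<Inter>(\<C> P) = P"
  by (auto simp: chi_def)

lemma irreducible_components_eq: "irreducible_components \<T> = \<C> ` minimal_elements \<Y>"
proof (intro equalityI subsetI)
  fix B assume "B \<in> irreducible_components \<T>"
  then have irr: "irreducible_in \<T> B" and max: "\<And>C. irreducible_in \<T> C \<Longrightarrow> B \<subseteq> C \<Longrightarrow> C = B"
    by (simp_all add: irreducible_components_def)
  have I: "\<Inter>B \<in> \<Y>"
    using irr by (rule Inter_irreducible_in_Upsilon)
  have "B \<subseteq> Abstract_Topology.closure_of \<T> B"
    using irr by (intro closure_of_subset) (simp add: irreducible_in_def)
  then have eq: "\<C> (\<Inter>B) = B"
    using max[OF irreducible_chi[OF I]] closure_irreducible_eq_chi[OF irr] by simp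
  have "Q = \<Inter>B" if Q: "Q \<in> \<Y>" "Q \<subseteq> \<Inter>B" for Q
  proof -
    have "B \<subseteq> \<C> Q"
      using chi_subset_chi_iff[OF I Q(1)] Q(2) eq by simp
    then have "\<C> Q = B"
      by (rule max[OF irreducible_chi[OF Q(1)]])
    then show ?thesis
      using Inter_chi[OF Q(1)] by simp
  qed
  then have "\<Inter>B \<in> minimal_elements \<Y>"
    using I unfolding minimal_elements_def by blast
  then show "B \<in> \<C> ` minimal_elements \<Y>"
    by (rule rev_image_eqI) (rule eq[symmetric])
next
  fix B assume "B \<in> \<C> ` minimal_elements \<Y>"
  then obtain I where I: "I \<in> \<Y>" and B: "B = \<C> I"
    and min: "\<And>Q. Q \<in> \<Y> \<Longrightarrow> Q \<subseteq> I \<Longrightarrow> Q = I"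
    unfolding minimal_elements_def by blast
  have "C = B" if C: "irreducible_in \<T> C" "B \<subseteq> C" for C
  proof -
    have "C \<subseteq> \<Y>"
      using C(1) topspace_zariski by (simp add: irreducible_in_def)
    then have CI: "C \<subseteq> \<C> (\<Inter>C)"
      by (auto simp: chi_def)
    have "I \<in> C"
      using I C(2) by (auto simp: B chi_def)
    then have "\<Inter>C = I"
      using min[OF Inter_irreducible_in_Upsilon[OF C(1)]] by blast
    then show ?thesis
      using CI C(2) B by simp
  qed
  then show "B \<in> irreducible_components \<T>"
    using irreducible_chi[OF I] B unfolding irreducible_components_def by blast
qed

lemma bij_betw_components_minimal:
  "bij_betw Inter (irreducible_components \<T>) (minimal_elements \<Y>)"
proof -
  have inv: "\<Inter>(\<C> P) = P" if "P \<in> minimal_elements \<Y>" for P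
    using that Inter_chi by (simp add: minimal_elements_def)
  show ?thesis
    unfolding irreducible_components_eq
    by (rule bij_betw_byWitness[of _ \<C>]) (use inv in auto)
qed

end

section \<open>Quotients by graded ideals\<close>

context graded_ring
begin

lemma coset_mem_quot_image_iff:
  assumes J: "ideal J R" and L: "ideal L R" and "J \<subseteq> L" and a: "a \<in> carrier R"
  shows "J +> a \<in> quot_image R J L \<longleftrightarrow> a \<in> L"
proof
  interpret L: ideal L R by fact
  assume "J +> a \<in> quot_image R J L"
  then obtain l where l: "l \<in> L" "J +> a = J +> l"
    by (auto simp: quot_image_def)
  then have "a \<ominus> l \<in> L"
    using quotient_eq_iff_same_a_r_cos[OF J a L.Icarr] \<open>J \<subseteq> L\<close> by blast
  then have "a \<ominus> l \<oplus> l \<in> L"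
    using l(1) by (rule L.a_closed)
  then show "a \<in> L"
    using a L.Icarr[OF l(1)] by (simp add: a_minus_def a_assoc l_neg)
qed (simp add: quot_image_def)

lemma quot_image_inj:
  assumes "ideal J R" "ideal L R" "ideal L' R" "J \<subseteq> L" "J \<subseteq> L'"
    and "quot_image R J L = quot_image R J L'"
  shows "L = L'"
  using coset_mem_quot_image_iff[of J L] coset_mem_quot_image_iff[of J L']
    ideal.Icarr[OF assms(2)] ideal.Icarr[OF assms(3)] assms by blast

lemma coset_eq_zero_iff:
  assumes "ideal J R" "a \<in> carrier R"
  shows "J +> a = \<zero>\<^bsub>R Quot J\<^esub> \<longleftrightarrow> a \<in> J"
  using a_rcos_zero[OF assms(1)] ideal.rcos_const_imp_mem[OF assms(1,2)]
  by (auto simp: FactRing_def)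

text \<open>That \<open>J\<close> itself is graded gives uniqueness of decompositions modulo \<open>J\<close>: a sum of
  homogeneous elements that lies in \<open>J\<close> has all its terms in \<open>J\<close>.\<close>

lemma quot_image_graded_ideal:
  assumes J: "graded_ideal G R Rg J" and L: "graded_ideal G R Rg L" and JL: "J \<subseteq> L"
  shows "graded_ideal G (R Quot J) (\<lambda>g. quot_image R J (Rg g)) (quot_image R J L)"
proof -
  have idJ: "ideal J R" and idL: "ideal L R"
    using J L by (simp_all add: graded_ideal_iff)
  interpret J: ideal J R by fact
  interpret L: ideal L R by fact
  interpret h: ring_hom_cring R "R Quot J" "(+>) J"
    by (rule J.rcos_ring_hom_cring[OF is_cring])
  have img: "additive_subgroup (quot_image R J S) (R Quot J)" if "additive_subgroup S R" for S
    using ring_hom_ring.img_is_add_subgroup[OF J.rcos_ring_hom_ring] that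
    by (simp add: additive_subgroup_def quot_image_def)
  have Q: "abelian_group (R Quot J)"
    using J.quotient_is_ring by (rule ring.is_abelian_group)
  have "internal_direct_sum (R Quot J) (carrier G)
      (\<lambda>g. quot_image R J L \<inter> quot_image R J (Rg g)) (quot_image R J L)"
  proof (rule internal_direct_sumI[OF Q])
    show "additive_subgroup (quot_image R J L \<inter> quot_image R J (Rg g)) (R Quot J)"
      if "g \<in> carrier G" for g
      using that by (intro additive_subgroup_Int Q img R_grading.summand_subgroup L.is_additive_subgroup)
    show "additive_subgroup (quot_image R J L) (R Quot J)"
      by (intro img L.is_additive_subgroup)
  next
    fix X assume "X \<in> quot_image R J L"
    then obtain l where l: "l \<in> L" "X = J +> l"
      by (auto simp: quot_image_def)
    then have lR: "l \<in> carrier R"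
      using L.Icarr by simp
    let ?F = "{g \<in> carrier G. R_grading.component l g \<noteq> \<zero>}"
    have "X = J +> finsum R (R_grading.component l) ?F"
      using l(2) R_grading.component_family(3)[OF lR] by simp
    also have "\<dots> = finsum (R Quot J) ((+>) J \<circ> R_grading.component l) ?F"
      by (rule h.hom_finsum) (auto intro: R_grading.component_carrier[OF lR])
    finally have "X = finsum (R Quot J) ((+>) J \<circ> R_grading.component l) ?F" .
    moreover have "((+>) J \<circ> R_grading.component l) g \<in> quot_image R J L \<inter> quot_image R J (Rg g)"
      if "g \<in> ?F" for g
      using that L l(1) R_grading.component_mem[OF lR]
      by (auto simp: quot_image_def graded_ideal_iff)
    ultimately show "\<exists>F c. finite F \<and> F \<subseteq> carrier G \<and>
        (\<forall>g\<in>F. c g \<in> quot_image R J L \<inter> quot_image R J (Rg g)) \<and> X = finsum (R Quot J) c F"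
      using R_grading.component_family(2)[OF lR]
      by (intro exI[of _ ?F] exI[of _ "(+>) J \<circ> R_grading.component l"]) auto
  next
    fix F c g
    assume F: "finite F" "F \<subseteq> carrier G" and g: "g \<in> F"
      and c: "\<And>g. g \<in> F \<Longrightarrow> c g \<in> quot_image R J L \<inter> quot_image R J (Rg g)"
      and sum: "finsum (R Quot J) c F = \<zero>\<^bsub>R Quot J\<^esub>"
    have "\<forall>g\<in>F. \<exists>a. a \<in> Rg g \<and> c g = J +> a"
    proof
      fix g assume "g \<in> F"
      then have "c g \<in> quot_image R J (Rg g)"
        using c by blast
      then show "\<exists>a. a \<in> Rg g \<and> c g = J +> a"
        unfolding quot_image_def by blast
    qed
    then obtain u where "\<forall>g\<in>F. u g \<in> Rg g \<and> c g = J +> u g"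
      by (auto dest!: bchoice)
    then have u: "\<And>g. g \<in> F \<Longrightarrow> u g \<in> Rg g" "\<And>g. g \<in> F \<Longrightarrow> c g = J +> u g"
      by simp_all
    have uR: "u \<in> F \<rightarrow> carrier R"
      using u(1) F(2) R_grading.summand_carrier by blast
    have "J +> finsum R u F = finsum (R Quot J) ((+>) J \<circ> u) F"
      using uR by (rule h.hom_finsum)
    also have "\<dots> = finsum (R Quot J) c F"
      by (rule h.S.finsum_cong') (use u(2) uR in \<open>auto simp: Pi_iff\<close>)
    finally have "finsum R u F \<in> J"
      using coset_eq_zero_iff[OF idJ, of "finsum R u F"] sum uR by simp
    then have "R_grading.component (finsum R u F) g \<in> J"
      using J g F(2) by (auto simp: graded_ideal_iff)
    then have "u g \<in> J"
      using R_grading.component_unique[OF F u(1), of g] g F(2) by auto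
    then show "c g = \<zero>\<^bsub>R Quot J\<^esub>"
      using coset_eq_zero_iff[OF idJ] u(2)[OF g] J.Icarr by simp
  qed auto
  then show ?thesis
    using ring_ideal_imp_quot_ideal[OF idJ idL]
    by (simp add: graded_ideal_def quot_image_def)
qed

lemma quot_image_graded_weakly_prime:
  assumes J: "graded_ideal G R Rg J" and L: "graded_weakly_prime G R Rg L" and JL: "J \<subseteq> L"
  shows "graded_weakly_prime G (R Quot J) (\<lambda>g. quot_image R J (Rg g)) (quot_image R J L)"
proof -
  have gL: "graded_ideal G R Rg L"
    and prime: "\<And>a b. a \<in> homogeneous_elements G Rg \<Longrightarrow> b \<in> homogeneous_elements G Rg \<Longrightarrow>
      a \<otimes> b \<noteq> \<zero> \<Longrightarrow> a \<otimes> b \<in> L \<Longrightarrow> a \<in> L \<or> b \<in> L"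
    using L by (auto simp: graded_weakly_prime_def)
  have idJ: "ideal J R" and idL: "ideal L R"
    using J gL by (simp_all add: graded_ideal_iff)
  interpret J: ideal J R by fact
  interpret L: ideal L R by fact
  have mem: "J +> a \<in> quot_image R J L \<longleftrightarrow> a \<in> L" if "a \<in> carrier R" for a
    using coset_mem_quot_image_iff[OF idJ idL JL that] .
  have carr: "carrier (R Quot J) = quot_image R J (carrier R)"
    by (auto simp: FactRing_def A_RCOSETS_def' quot_image_def)
  have "quot_image R J L \<noteq> carrier (R Quot J)"
  proof
    assume eq: "quot_image R J L = carrier (R Quot J)"
    have "a \<in> L" if "a \<in> carrier R" for a
      using mem[OF that] that unfolding eq carr by (simp add: quot_image_def)
    then show False
      using L L.a_subset by (auto simp: graded_weakly_prime_def)
  qed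
  moreover have "A \<in> quot_image R J L \<or> B \<in> quot_image R J L"
    if A: "A \<in> homogeneous_elements G (\<lambda>g. quot_image R J (Rg g))"
      and B: "B \<in> homogeneous_elements G (\<lambda>g. quot_image R J (Rg g))"
      and AB: "A \<otimes>\<^bsub>R Quot J\<^esub> B \<noteq> \<zero>\<^bsub>R Quot J\<^esub>" "A \<otimes>\<^bsub>R Quot J\<^esub> B \<in> quot_image R J L" for A B
  proof -
    \<comment> \<open>Homogeneous cosets have homogeneous representatives; a nonzero product of cosets has a
      representative outside \<open>J\<close>, hence a nonzero one.\<close>
    obtain a b where a: "a \<in> homogeneous_elements G Rg" "A = J +> a"
      and b: "b \<in> homogeneous_elements G Rg" "B = J +> b"
      using A B by (auto simp: homogeneous_elements_def quot_image_def)
    then have R: "a \<in> carrier R" "b \<in> carrier R"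
      using R_grading.summand_carrier by (auto simp: homogeneous_elements_def)
    have "A \<otimes>\<^bsub>R Quot J\<^esub> B = J +> a \<otimes> b"
      using J.rcoset_mult_add[OF R] a(2) b(2) by (simp add: FactRing_def)
    then have ab: "a \<otimes> b \<notin> J" "a \<otimes> b \<in> L"
      using AB R coset_eq_zero_iff[OF idJ] mem by auto
    then have "a \<otimes> b \<noteq> \<zero>"
      using J.zero_closed by auto
    then have "a \<in> L \<or> b \<in> L"
      using ab(2) by (rule prime[OF a(1) b(1)])
    then show ?thesis
      by (simp add: a(2) b(2) mem R)
  qed
  ultimately show ?thesis
    using quot_image_graded_ideal[OF J gL JL] by (auto simp: graded_weakly_prime_def)
qed

end

section \<open>Pseudo weakly primeful modules\<close>

context graded_module
begin

lemma annihilator_graded_ideal: "graded_ideal G R Rg (annihilator R M)"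
  unfolding annihilator_def using zero_graded_submodule by (rule residual_graded_ideal)

lemma annihilator_subset_residual: "P \<in> \<Y> \<Longrightarrow> annihilator R M \<subseteq> residual R M P"
  using additive_subgroup.zero_closed[OF submodule_additive_subgroup[OF Upsilon_submodule]]
  by (auto simp: annihilator_def residual_def)

lemma residual_in_chi_ring:
  "P \<in> \<Y> \<Longrightarrow> residual R M P \<in> chi_ring G R Rg (annihilator R M)"
  using annihilator_subset_residual by (auto simp: chi_ring_def GWSpec_def Upsilon_def)

lemma chi_ring_graded_ideal: "L \<in> chi_ring G R Rg J \<Longrightarrow> graded_ideal G R Rg L"
  by (simp add: chi_ring_def GWSpec_def graded_weakly_prime_def)

text \<open>The zero module is pseudo weakly primeful by convention, without any surjectivity; then
  there are no ideals to consider.\<close>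

lemma chi_ring_trivial_module:
  assumes "carrier M = {\<zero>\<^bsub>M\<^esub>}"
  shows "chi_ring G R Rg (annihilator R M) = {}"
proof -
  have "annihilator R M = carrier R"
    using assms by (auto simp: annihilator_def residual_def)
  then have "L = carrier R" if "L \<in> chi_ring G R Rg (annihilator R M)" for L
    using that graded_ideal_subset[OF chi_ring_graded_ideal[OF that]] by (simp add: chi_ring_def)
  moreover have "L \<noteq> carrier R" if "L \<in> chi_ring G R Rg (annihilator R M)" for L
    using that by (simp add: chi_ring_def GWSpec_def graded_weakly_prime_def)
  ultimately show ?thesis by blast
qed

lemma primeful_residual_surj:
  assumes prim: "graded_pseudo_weakly_primeful G R Rg M Mg"
    and L: "L \<in> chi_ring G R Rg (annihilator R M)"
  shows "\<exists>P\<in>\<Y>. residual R M P = L"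
proof -
  let ?A = "annihilator R M"
  have wp: "graded_weakly_prime G R Rg L" and AL: "?A \<subseteq> L"
    using L by (auto simp: chi_ring_def GWSpec_def)
  have "carrier M \<noteq> {\<zero>\<^bsub>M\<^esub>}"
    using L chi_ring_trivial_module by auto
  then have "quot_image R ?A L \<in> natural_map R M ` \<Y>"
    using prim quot_image_graded_weakly_prime[OF annihilator_graded_ideal wp AL]
    by (simp add: graded_pseudo_weakly_primeful_def GWSpec_def)
  then obtain P where P: "P \<in> \<Y>" "quot_image R ?A L = quot_image R ?A (residual R M P)"
    by (auto simp: natural_map_def)
  have "L = residual R M P"
    using quot_image_inj[OF _ _ _ AL annihilator_subset_residual[OF P(1)] P(2)]
      annihilator_graded_ideal chi_ring_graded_ideal[OF L]
      chi_ring_graded_ideal[OF residual_in_chi_ring[OF P(1)]]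
    by (simp add: graded_ideal_iff)
  then show ?thesis
    using P(1) by blast
qed

lemma prod_subset_iff:
  assumes "L \<in> chi_ring G R Rg J" "P \<in> \<Y>"
  shows "ideal_module_prod M L \<subseteq> P \<longleftrightarrow> L \<subseteq> residual R M P"
  using ideal_module_prod_subset_iff[OF _ Upsilon_submodule[OF assms(2)], of L]
    graded_ideal_subset[OF chi_ring_graded_ideal[OF assms(1)]]
  by simp

lemma primeful_prod:
  assumes prim: "graded_pseudo_weakly_primeful G R Rg M Mg"
    and L: "L \<in> chi_ring G R Rg (annihilator R M)"
  shows "residual R M (ideal_module_prod M L) = L" "ideal_module_prod M L \<in> \<Y>"
proof -
  obtain P where P: "P \<in> \<Y>" "residual R M P = L"
    using primeful_residual_surj[OF assms] by blast
  have gL: "graded_ideal G R Rg L"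
    using L by (rule chi_ring_graded_ideal)
  then have LR: "L \<subseteq> carrier R"
    by (rule graded_ideal_subset)
  have LM: "graded_submodule G R M Mg (ideal_module_prod M L)"
    using ideal_module_prod_graded[OF LR] gL by (simp add: graded_ideal_iff)
  then have "L \<subseteq> residual R M (ideal_module_prod M L)"
    using ideal_module_prod_subset_iff[OF LR, of "ideal_module_prod M L"]
    by (simp add: graded_submodule_iff)
  moreover have "ideal_module_prod M L \<subseteq> P"
    using prod_subset_iff[OF L P(1)] P(2) by simp
  then have "residual R M (ideal_module_prod M L) \<subseteq> L"
    unfolding P(2)[symmetric] by (auto simp: residual_def)
  ultimately show res: "residual R M (ideal_module_prod M L) = L" by blast
  show "ideal_module_prod M L \<in> \<Y>"
    using LM res L by (simp add: Upsilon_def chi_ring_def GWSpec_def)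
qed

lemma primeful_minimal_elements:
  assumes prim: "graded_pseudo_weakly_primeful G R Rg M Mg"
  shows "minimal_elements \<Y> =
    ideal_module_prod M ` minimal_elements (chi_ring G R Rg (annihilator R M))"
proof (intro equalityI subsetI)
  let ?X = "chi_ring G R Rg (annihilator R M)"
  fix P assume "P \<in> minimal_elements \<Y>"
  then have P: "P \<in> \<Y>" and min: "\<And>Q. Q \<in> \<Y> \<Longrightarrow> Q \<subseteq> P \<Longrightarrow> Q = P"
    by (auto simp: minimal_elements_def)
  have eq: "ideal_module_prod M L = P" if "L \<in> ?X" "L \<subseteq> residual R M P" for L
    using min primeful_prod(2)[OF prim that(1)] prod_subset_iff[OF that(1) P] that(2) by blast
  have res: "residual R M P \<in> ?X"
    using P by (rule residual_in_chi_ring)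
  have "L = residual R M P" if "L \<in> ?X" "L \<subseteq> residual R M P" for L
    using primeful_prod(1)[OF prim that(1)] eq[OF that] by simp
  then have "residual R M P \<in> minimal_elements ?X"
    using res by (auto simp: minimal_elements_def)
  moreover have "P = ideal_module_prod M (residual R M P)"
    using eq[OF res subset_refl] by simp
  ultimately show "P \<in> ideal_module_prod M ` minimal_elements ?X"
    by (rule rev_image_eqI)
next
  let ?X = "chi_ring G R Rg (annihilator R M)"
  fix P assume "P \<in> ideal_module_prod M ` minimal_elements ?X"
  then obtain L where L: "L \<in> ?X" and min: "\<And>L'. L' \<in> ?X \<Longrightarrow> L' \<subseteq> L \<Longrightarrow> L' = L"
    and P: "P = ideal_module_prod M L"
    by (auto simp: minimal_elements_def)
  have "Q = P" if Q: "Q \<in> \<Y>" "Q \<subseteq> P" for Q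
  proof -
    have "residual R M Q \<subseteq> residual R M P"
      using Q(2) by (auto simp: residual_def)
    then have "residual R M Q = L"
      using min[OF residual_in_chi_ring[OF Q(1)]] primeful_prod(1)[OF prim L] P by simp
    then show ?thesis
      using prod_subset_iff[OF L Q(1)] Q(2) P by blast
  qed
  then show "P \<in> minimal_elements \<Y>"
    using primeful_prod(2)[OF prim L] P by (auto simp: minimal_elements_def)
qed

end


theorem theorem3p10:
  fixes G :: "('g, 'c) monoid_scheme"
    and R :: "('a, 'r) ring_scheme" and Rg :: "'g \<Rightarrow> 'a set"
    and M :: "('a, 'b, 'm) module_scheme" and Mg :: "'g \<Rightarrow> 'b set"
    and P :: "'b set set"
  assumes "graded_module G R Rg M Mg"
    and "graded_weakly_topological G R Rg M Mg"
    and "P \<subseteq> Upsilon G R Rg M Mg"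
  shows
    "(irreducible_in (zariski_topology G R Rg M Mg) P \<and>
      closedin (zariski_topology G R Rg M Mg) P
        \<longleftrightarrow> (\<exists>I\<in>Upsilon G R Rg M Mg. P = chi G R Rg M Mg I)) \<and>
     (\<forall>Y. irreducible_in (zariski_topology G R Rg M Mg) Y \<and>
          closedin (zariski_topology G R Rg M Mg) Y
        \<longrightarrow> (\<exists>x. generic_point (zariski_topology G R Rg M Mg) Y x)) \<and>
     (\<exists>f. bij_betw f (irreducible_components (zariski_topology G R Rg M Mg))
            (minimal_elements (Upsilon G R Rg M Mg)) \<and>
          irreducible_components (zariski_topology G R Rg M Mg)
            \<subseteq> chi G R Rg M Mg ` Upsilon G R Rg M Mg \<and>
          (\<forall>I\<in>Upsilon G R Rg M Mg.
             chi G R Rg M Mg I \<in> irreducible_components (zariski_topology G R Rg M Mg)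
               \<longrightarrow> f (chi G R Rg M Mg I) = I)) \<and>
     (graded_pseudo_weakly_primeful G R Rg M Mg \<longrightarrow>
        irreducible_components (zariski_topology G R Rg M Mg) =
          {chi G R Rg M Mg (ideal_module_prod M L) | L.
             L \<in> minimal_elements (chi_ring G R Rg (annihilator R M))})"
proof -
  interpret graded_module G R Rg M Mg by fact
  have part1: "irreducible_in \<T> P \<and> closedin \<T> P \<longleftrightarrow> (\<exists>I\<in>\<Y>. P = \<C> I)"
    by (rule irreducible_closed_iff)
  have generic: "\<exists>x. generic_point \<T> Y x" if Y: "irreducible_in \<T> Y \<and> closedin \<T> Y" for Y
  proof -
    obtain I where "I \<in> \<Y>" "Y = \<C> I"
      using Y irreducible_closed_iff[of Y] by blast
    then have "generic_point \<T> Y I"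
      using closure_singleton[of I] by (simp add: generic_point_def chi_def)
    then show ?thesis ..
  qed
  have "minimal_elements \<Y> \<subseteq> \<Y>"
    by (auto simp: minimal_elements_def)
  then have comps: "irreducible_components \<T> \<subseteq> \<C> ` \<Y>"
    unfolding irreducible_components_eq by (rule image_mono)
  have part2: "\<exists>f. bij_betw f (irreducible_components \<T>) (minimal_elements \<Y>) \<and>
      irreducible_components \<T> \<subseteq> \<C> ` \<Y> \<and>
      (\<forall>I\<in>\<Y>. \<C> I \<in> irreducible_components \<T> \<longrightarrow> f (\<C> I) = I)"
    by (intro exI[of _ Inter] conjI bij_betw_components_minimal comps ballI impI Inter_chi)
  have part3: "irreducible_components \<T> = {\<C> (ideal_module_prod M L) | L.
      L \<in> minimal_elements (chi_ring G R Rg (annihilator R M))}"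
    if "graded_pseudo_weakly_primeful G R Rg M Mg"
    unfolding irreducible_components_eq primeful_minimal_elements[OF that] image_image
    by (rule Setcompr_eq_image[symmetric])
  show ?thesis
    by (intro conjI part1 part2 allI impI generic part3) simp_all
qed

end
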